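(* Let $k$ and $n$ be non-negative integers. Let $p\ge5$ be a prime with $p\equiv 5\pmod 6$. Then for any integer $j\not\equiv 0\pmod p$, $$B_3\left(p^{2k+2}n+p^{2k+1}j+\frac{p^{2k+2}-1}{6}\right)\equiv 0\pmod 3.$$
   Context: A partition is called $3$-regular if none of its parts is divisible by $3$. $B_3(n)$ denotes the number of ordered pairs $(\lambda,\mu)$ of $3$-regular partitions such that the sum of all parts of $\lambda$ and $\mu$ equals $n$ (so $B_3(0)=1$); equivalently $\sum_{n\ge 0}B_3(n)q^n=\prod_{k\ge1}\frac{(1-q^{3k})^2}{(1-q^k)^2}$. By convention $B_3(n)=0$ for negative integers $n$. *)

theory Defs
  imports "HOL-Number_Theory.Number_Theory" "HOL-Library.Multiset"
begin

definition is_partition :: "nat multiset \<Rightarrow> bool" where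
  "is_partition P \<longleftrightarrow> (\<forall>x \<in># P. x > 0)"

definition regular_partition :: "nat \<Rightarrow> nat multiset \<Rightarrow> bool" where
  "regular_partition l P \<longleftrightarrow> is_partition P \<and> (\<forall>x \<in># P. \<not> l dvd x)"

definition regular_bipartitions :: "nat \<Rightarrow> int \<Rightarrow> (nat multiset \<times> nat multiset) set" where
  "regular_bipartitions l n =
     {(P, Q). regular_partition l P \<and> regular_partition l Q \<and> int (\<Sum>\<^sub># P + \<Sum>\<^sub># Q) = n}"

(* The argument is an integer, so that the value at a negative integer is 0. *)
definition B3 :: "int \<Rightarrow> nat" where
  "B3 n = card (regular_bipartitions 3 n)"

lemma size_le_sum_partition: "is_partition P \<Longrightarrow> size P \<le> \<Sum>\<^sub># P"
proof (induction P)
  case (add x P)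
  hence "size P \<le> \<Sum>\<^sub># P" and "x > 0" by (simp_all add: is_partition_def)
  thus ?case by simp
qed simp

lemma finite_partitions_bounded: "finite {P. is_partition P \<and> \<Sum>\<^sub># P \<le> n}"
proof (rule finite_subset)
  show "{P. is_partition P \<and> \<Sum>\<^sub># P \<le> n} \<subseteq> mset ` {xs. set xs \<subseteq> {..n} \<and> length xs \<le> n}"
  proof
    fix P assume "P \<in> {P. is_partition P \<and> \<Sum>\<^sub># P \<le> n}"
    hence P: "is_partition P" "\<Sum>\<^sub># P \<le> n" by simp_all
    obtain xs where xs: "mset xs = P" using ex_mset by blast
    have "length xs \<le> n"
      using size_le_sum_partition[OF P(1)] P(2) unfolding xs[symmetric] by simp
    moreover have "set xs \<subseteq> {..n}"
    proof
      fix x assume "x \<in> set xs"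
      hence "x \<le> sum_list xs" by (simp add: member_le_sum_list)
      also have "\<dots> \<le> n" using P(2) by (simp add: xs[symmetric] sum_mset_sum_list)
      finally show "x \<in> {..n}" by simp
    qed
    ultimately show "P \<in> mset ` {xs. set xs \<subseteq> {..n} \<and> length xs \<le> n}"
      using xs by blast
  qed
  show "finite (mset ` {xs. set xs \<subseteq> {..n} \<and> length xs \<le> n})"
    by (intro finite_imageI finite_lists_length_le) simp
qed

lemma finite_regular_bipartitions: "finite (regular_bipartitions l n)"
proof (rule finite_subset)
  let ?A = "{P. is_partition P \<and> \<Sum>\<^sub># P \<le> nat n}"
  show "regular_bipartitions l n \<subseteq> ?A \<times> ?A"
  proof
    fix z assume "z \<in> regular_bipartitions l n"
    then obtain P Q where z: "z = (P, Q)" and PQ: "is_partition P" "is_partition Q"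
      and n: "int (\<Sum>\<^sub># P + \<Sum>\<^sub># Q) = n"
      unfolding regular_bipartitions_def regular_partition_def by blast
    from n have "\<Sum>\<^sub># P + \<Sum>\<^sub># Q = nat n" by linarith
    with z PQ show "z \<in> ?A \<times> ?A" by simp
  qed
  show "finite (?A \<times> ?A)" using finite_partitions_bounded by blast
qed

lemma B3_neg:
  assumes "n < 0"
  shows "B3 n = 0"
proof -
  have "int (\<Sum>\<^sub># P + \<Sum>\<^sub># Q) \<noteq> n" for P Q :: "nat multiset" using assms by linarith
  hence "regular_bipartitions 3 n = {}" unfolding regular_bipartitions_def by blast
  thus ?thesis unfolding B3_def by simp
qed

lemma B3_0: "B3 0 = 1"
proof -
  have "regular_bipartitions 3 0 = {({#}, {#})}"
  proof (intro equalityI subsetI)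
    fix z assume "z \<in> regular_bipartitions 3 0"
    then obtain P Q where z: "z = (P, Q)" and PQ: "is_partition P" "is_partition Q"
      and n: "int (\<Sum>\<^sub># P + \<Sum>\<^sub># Q) = 0"
      unfolding regular_bipartitions_def regular_partition_def by blast
    from n have "\<Sum>\<^sub># P = 0" "\<Sum>\<^sub># Q = 0" by linarith+
    hence "size P = 0" "size Q = 0" using PQ[THEN size_le_sum_partition] by linarith+
    thus "z \<in> {({#}, {#})}" using z by simp
  qed (simp add: regular_bipartitions_def regular_partition_def is_partition_def)
  thus ?thesis by (simp add: B3_def)
qed

end

theory Submission
  imports Defs "HOL-Computational_Algebra.Formal_Power_Series"
begin

text \<open>
  Write \<open>E(q)\<close> for the product of all \<open>1 - q\<^sup>k\<close>. Since \<open>E(q)\<^sup>3 \<equiv> E(q\<^sup>3)\<close> modulo 3, the generating function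
  of \<open>B3\<close> satisfies \<open>E(q\<^sup>3)\<^sup>2 / E(q)\<^sup>2 \<equiv> E(q) E(q\<^sup>3)\<close>. By the pentagonal number theorem, the coefficient
  of \<open>q\<^sup>N\<close> on the right vanishes unless \<open>4 (6 N + 1) = 24 N + 4\<close> has the form \<open>x\<^sup>2 + 3 y\<^sup>2\<close>. As \<open>-3\<close> is
  not a square modulo \<open>p\<close>, the prime \<open>p\<close> divides such a number to an even power, whereas for the \<open>N\<close>
  in question it divides \<open>6 N + 1\<close> exactly \<open>2 k + 1\<close> times.
\<close>

section \<open>The pentagonal number theorem\<close>


text \<open>Shanks' finite form of the pentagonal number theorem. The summand for \<open>s = 0\<close> is the truncated
  Euler product, and all the others are divisible by \<open>x\<^sup>n\<^sup>+\<^sup>1\<close>.\<close>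

lemma shanks_identity:
  fixes x :: "'a::comm_ring_1"
  shows "(\<Sum>s\<le>n. (-1) ^ s * (\<Prod>k\<in>{s<..n}. 1 - x ^ k) * x ^ (s * n + s * (s + 1) div 2)) =
         1 + (\<Sum>s\<in>{1..n}. (-1) ^ s * (x ^ (s * (3 * s - 1) div 2) + x ^ (s * (3 * s + 1) div 2)))"
proof (induction n)
  case 0
  show ?case by simp
next
  case (Suc n)
  define t where "t = (\<lambda>s::nat. s * (s + 1) div 2)"
  define Q where "Q = (\<lambda>(m::nat) s. \<Prod>k\<in>{s<..m}. 1 - x ^ k)"
  have t_Suc: "t (Suc s) = t s + Suc s" for s by (simp add: t_def)
  have Q_Suc: "Q (Suc n) s = Q n s * (1 - x ^ Suc n)" if "s \<le> n" for s
  proof -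
    have "{s<..Suc n} = insert (Suc n) {s<..n}" using that by auto
    thus ?thesis by (simp add: Q_def mult.commute)
  qed
  have Q_low: "Q n s * (1 - x ^ s) = Q n (s - 1)" if "1 \<le> s" "s \<le> n" for s
  proof -
    have "{s - 1<..n} = insert s {s<..n}" using that by auto
    thus ?thesis by (simp add: Q_def mult.commute)
  qed
  \<comment> \<open>Telescoping certificate: in the new summand, the \<open>x ^ Suc n\<close> part
    of the last factor gives \<open>- w s\<close>. What is left differs from the old summand by a
    factor \<open>1 - x ^ s\<close>, which \<open>Q_low\<close> absorbs to give
    \<open>w (s - 1)\<close>.\<close>
  define w where "w = (\<lambda>s. (-1) ^ s * Q n s * x ^ (s * Suc n + t s + Suc n))"
  have term_diff: "(-1) ^ s * Q (Suc n) s * x ^ (s * Suc n + t s) - (-1) ^ s * Q n s * x ^ (s * n + t s)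
      = (if s = 0 then 0 else w (s - 1)) - w s" if "s \<le> n" for s
  proof (cases s)
    case 0
    thus ?thesis using Q_Suc[of 0] by (simp add: w_def t_def algebra_simps)
  next
    case (Suc r)
    have e: "s * n + t s = r * Suc n + t r + Suc n"
      using Suc t_Suc[of r] by (simp add: algebra_simps)
    have "(-1) ^ s * Q (Suc n) s * x ^ (s * Suc n + t s) - (-1) ^ s * Q n s * x ^ (s * n + t s)
        = - ((-1) ^ s * (Q n s * (1 - x ^ s)) * x ^ (s * n + t s)) - w s"
      unfolding Q_Suc[OF that] by (simp add: w_def power_add algebra_simps)
    also have "\<dots> = w r - w s"
      using Q_low[of s] that Suc unfolding e by (simp add: w_def)
    finally show ?thesis using Suc by simp
  qed
  have tele: "(\<Sum>s\<le>m. (if s = 0 then 0 else w (s - 1)) - w s) = - w m" for m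
    by (induction m) auto
  have diff: "(\<Sum>s\<le>n. (-1) ^ s * Q (Suc n) s * x ^ (s * Suc n + t s))
      - (\<Sum>s\<le>n. (-1) ^ s * Q n s * x ^ (s * n + t s)) = - w n"
    unfolding sum_subtractf[symmetric] tele[symmetric] by (intro sum.cong refl term_diff) simp
  \<comment> \<open>Only the boundary term \<open>- w n\<close> and the new summand at
    \<open>Suc n\<close> remain; their exponents are the two generalized pentagonal numbers of index
    \<open>Suc n\<close>.\<close>
  have e1: "n * Suc n + t n + Suc n = Suc n * (3 * Suc n - 1) div 2"
  proof -
    have "Suc n * (3 * Suc n - 1) = n * (n + 1) + (n * Suc n + Suc n) * 2"
      by (simp add: algebra_simps)
    thus ?thesis by (simp only: t_def div_mult_self2) simp
  qed
  have e2: "Suc n * Suc n + t (Suc n) = Suc n * (3 * Suc n + 1) div 2"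
  proof -
    have "Suc n * (3 * Suc n + 1) = Suc n * (Suc n + 1) + (Suc n * Suc n) * 2"
      by (simp add: algebra_simps)
    thus ?thesis by (simp only: t_def div_mult_self1)
  qed
  define G where "G = (\<lambda>n. \<Sum>s\<in>{1..n}. (-1) ^ s * (x ^ (s * (3 * s - 1) div 2) + x ^ (s * (3 * s + 1) div 2)))"
  have IH: "(\<Sum>s\<le>n. (-1) ^ s * Q n s * x ^ (s * n + t s)) = 1 + G n"
    using Suc.IH by (simp only: Q_def t_def G_def)
  have G_Suc: "G (Suc n) = G n
      + (-1) ^ Suc n * (x ^ (Suc n * (3 * Suc n - 1) div 2) + x ^ (Suc n * (3 * Suc n + 1) div 2))"
    by (simp only: G_def sum.cl_ivl_Suc) simp
  have Q_same: "Q m m = 1" for m by (simp add: Q_def)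
  have "(\<Sum>s\<le>Suc n. (-1) ^ s * Q (Suc n) s * x ^ (s * Suc n + t s))
      = (\<Sum>s\<le>n. (-1) ^ s * Q (Suc n) s * x ^ (s * Suc n + t s))
        + (-1) ^ Suc n * x ^ (Suc n * (3 * Suc n + 1) div 2)"
    by (simp only: sum.atMost_Suc Q_same mult_1_right e2)
  also have "(\<Sum>s\<le>n. (-1) ^ s * Q (Suc n) s * x ^ (s * Suc n + t s)) = 1 + G n - w n"
    using diff unfolding IH by (simp only: diff_eq_eq) simp
  also have "w n = - ((-1) ^ Suc n * x ^ (Suc n * (3 * Suc n - 1) div 2))"
    by (simp only: w_def e1 Q_same) simp
  also have "1 + G n - - ((-1) ^ Suc n * x ^ (Suc n * (3 * Suc n - 1) div 2))
      + (-1) ^ Suc n * x ^ (Suc n * (3 * Suc n + 1) div 2) = 1 + G (Suc n)"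
    by (simp only: G_Suc distrib_left diff_minus_eq_add add.assoc)
  finally show ?case by (simp only: Q_def t_def G_def)
qed

text \<open>Completing the square: \<open>12 * s * (3 * s - 1) + 1\<close> and
  \<open>12 * s * (3 * s + 1) + 1\<close> are the squares of \<open>6 * s - 1\<close> and
  \<open>6 * s + 1\<close>.\<close>

lemma pentagonal_24:
  "\<exists>x::int. 24 * int (s * (3 * s - 1) div 2) + 1 = x ^ 2"
  "\<exists>x::int. 24 * int (s * (3 * s + 1) div 2) + 1 = x ^ 2"
proof -
  have "even (s * (3 * s - 1))" by (cases s) simp_all
  hence "24 * (s * (3 * s - 1) div 2) = 12 * (s * (3 * s - 1))" by presburger
  moreover have "int (s * (3 * s - 1)) = int s * (3 * int s - 1)"
    by (cases s) (auto simp: algebra_simps)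
  ultimately have "24 * int (s * (3 * s - 1) div 2) = 12 * (int s * (3 * int s - 1))" by linarith
  thus "\<exists>x::int. 24 * int (s * (3 * s - 1) div 2) + 1 = x ^ 2"
    by (intro exI[of _ "6 * int s - 1"]) (simp add: power2_eq_square algebra_simps)
  have "even (s * (3 * s + 1))" by simp
  hence "24 * (s * (3 * s + 1) div 2) = 12 * (s * (3 * s + 1))" by presburger
  moreover have "int (s * (3 * s + 1)) = int s * (3 * int s + 1)" by (simp add: algebra_simps)
  ultimately have "24 * int (s * (3 * s + 1) div 2) = 12 * (int s * (3 * int s + 1))" by linarith
  thus "\<exists>x::int. 24 * int (s * (3 * s + 1) div 2) + 1 = x ^ 2"
    by (intro exI[of _ "6 * int s + 1"]) (simp add: power2_eq_square algebra_simps)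
qed

text \<open>Below degree \<open>d * (n + 1)\<close> the truncated product agrees with the pentagonal
  series in \<open>fps_X ^ d\<close>, so \<open>i\<close> is \<open>d\<close> times a generalized
  pentagonal number. The cases \<open>d = 1\<close> and \<open>d = 3\<close> are the ones needed for
  the two Euler products.\<close>

lemma euler_product_coeff_nonzero:
  assumes "d > 0" and "i < d * (n + 1)"
    and nz: "fps_nth (\<Prod>k\<in>{1..n}. 1 - (fps_X ^ d) ^ k :: int fps) i \<noteq> 0"
  obtains x :: int where "24 * int i + int d = int d * x ^ 2"
proof -
  let ?X = "fps_X ^ d :: int fps"
  define H where "H = (\<Sum>s\<in>{1..n}. (-1) ^ s * (\<Prod>k\<in>{s<..n}. 1 - ?X ^ k) * ?X ^ (s * n + s * (s + 1) div 2))"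
  define G where "G = (\<Sum>s\<in>{1..n}. (-1) ^ s * (?X ^ (s * (3 * s - 1) div 2) + ?X ^ (s * (3 * s + 1) div 2)))"
  have "{..n} = insert 0 {1..n}" "{0<..n} = {1..n}" by auto
  hence eq: "(\<Prod>k\<in>{1..n}. 1 - ?X ^ k) = 1 + G - H"
    using shanks_identity[where x = ?X and n = n] by (simp add: G_def H_def eq_diff_eq add.commute)
  have "fps_nth ((-1) ^ s * (\<Prod>k\<in>{s<..n}. 1 - ?X ^ k) * ?X ^ (s * n + s * (s + 1) div 2)) i = 0"
    if s: "s \<in> {1..n}" for s
  proof -
    obtain r where r: "s = Suc r" using s by (auto dest: Suc_le_D)
    have "n + 1 \<le> s * n + s * (s + 1) div 2" by (simp add: r)
    hence "i < d * (s * n + s * (s + 1) div 2)"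
      using assms(2) by (meson less_le_trans mult_le_mono2)
    thus ?thesis by (simp add: power_mult[symmetric] fps_X_power_mult_right_nth)
  qed
  hence "fps_nth H i = 0" by (simp add: H_def fps_sum_nth)
  hence "fps_nth (1 + G) i \<noteq> 0" using nz by (simp only: eq fps_sub_nth diff_zero not_False_eq_True)
  hence "i = 0 \<or> fps_nth G i \<noteq> 0" by (auto split: if_splits)
  thus thesis
  proof
    assume "i = 0"
    thus thesis using that[of 1] by simp
  next
    assume "fps_nth G i \<noteq> 0"
    then obtain s where
      "fps_nth ((-1) ^ s * (?X ^ (s * (3 * s - 1) div 2) + ?X ^ (s * (3 * s + 1) div 2))) i \<noteq> 0"
      unfolding G_def fps_sum_nth by (meson sum.neutral)
    hence "fps_nth (?X ^ (s * (3 * s - 1) div 2) + ?X ^ (s * (3 * s + 1) div 2)) i \<noteq> 0"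
      by (cases "even s") simp_all
    hence "i = d * (s * (3 * s - 1) div 2) \<or> i = d * (s * (3 * s + 1) div 2)"
      by (auto simp: power_mult[symmetric] fps_X_power_nth split: if_splits)
    then obtain e where e: "i = d * e" and "\<exists>x::int. 24 * int e + 1 = x ^ 2"
      using pentagonal_24 by blast
    then obtain x :: int where "24 * int e + 1 = x ^ 2" by blast
    hence "int d * (24 * int e + 1) = int d * x ^ 2" by simp
    thus thesis using that[of x] by (simp add: e algebra_simps)
  qed
qed

section \<open>Generating functions of partitions\<close>

definition partitions_in :: "nat set \<Rightarrow> nat \<Rightarrow> nat multiset set" where
  "partitions_in S n = {P. set_mset P \<subseteq> S \<and> \<Sum>\<^sub># P = n}"

lemma finite_partitions_in: "0 \<notin> S \<Longrightarrow> finite (partitions_in S n)"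
  by (rule finite_subset[OF _ finite_partitions_bounded[of n]])
     (auto simp: partitions_in_def is_partition_def intro!: Nat.gr0I)

text \<open>Removing one copy of \<open>k\<close> is a bijection from the partitions containing
  \<open>k\<close>; other copies may remain, hence \<open>insert k S\<close> on the right. This is
  multiplication by \<open>1 - fps_X ^ k\<close>, read off coefficientwise.\<close>

lemma card_partitions_in_insert:
  assumes "0 \<notin> S" and "k > 0" and "k \<notin> S"
  shows "card (partitions_in (insert k S) n) =
         card (partitions_in S n) + (if k \<le> n then card (partitions_in (insert k S) (n - k)) else 0)"
proof -
  let ?A = "if k \<le> n then add_mset k ` partitions_in (insert k S) (n - k) else {}"
  have fin: "finite (partitions_in T m)" if "T \<subseteq> insert k S" for T m
    using assms that by (intro finite_partitions_in) auto
  have "partitions_in (insert k S) n = partitions_in S n \<union> ?A"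
  proof (intro equalityI subsetI)
    fix P assume P: "P \<in> partitions_in (insert k S) n"
    show "P \<in> partitions_in S n \<union> ?A"
    proof (cases "k \<in># P")
      case True
      then obtain R where R: "P = add_mset k R" by (blast dest: multi_member_split)
      have "k + \<Sum>\<^sub># R = n" "set_mset R \<subseteq> insert k S"
        using P by (simp_all add: R partitions_in_def)
      hence "k \<le> n" "R \<in> partitions_in (insert k S) (n - k)"
        by (simp_all add: partitions_in_def flip: \<open>k + \<Sum>\<^sub># R = n\<close>)
      thus ?thesis using R by simp
    next
      case False
      hence "P \<in> partitions_in S n" using P by (auto simp: partitions_in_def)
      thus ?thesis by blast
    qed
  next
    fix P assume "P \<in> partitions_in S n \<union> ?A"
    then consider "P \<in> partitions_in S n"
      | R where "k \<le> n" "P = add_mset k R" "R \<in> partitions_in (insert k S) (n - k)"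
      by (cases "k \<le> n") auto
    thus "P \<in> partitions_in (insert k S) n"
      by cases (auto simp: partitions_in_def)
  qed
  moreover have "partitions_in S n \<inter> ?A = {}"
  proof -
    have "add_mset k R \<notin> partitions_in S n" for R
      using \<open>k \<notin> S\<close> by (simp add: partitions_in_def)
    thus ?thesis by auto
  qed
  moreover have "card ?A = (if k \<le> n then card (partitions_in (insert k S) (n - k)) else 0)"
    by (auto intro!: card_image inj_onI)
  moreover have "finite (partitions_in S n)" "finite ?A" using fin by auto
  ultimately show ?thesis by (simp add: card_Un_disjoint)
qed

text \<open>The recurrence above cancels one factor for each element of \<open>S\<close>. The
  product form makes the counting series an explicit inverse over the integers.\<close>

lemma partitions_in_fps:
  assumes "finite S" and "0 \<notin> S"
  shows "Abs_fps (\<lambda>n. int (card (partitions_in S n))) * (\<Prod>k\<in>S. 1 - fps_X ^ k) = 1"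
  using assms
proof (induction S)
  case empty
  have "partitions_in {} n = (if n = 0 then {{#}} else {})" for n
    by (auto simp: partitions_in_def)
  thus ?case by (intro fps_ext) auto
next
  case (insert k S)
  let ?F = "\<lambda>S. Abs_fps (\<lambda>n. int (card (partitions_in S n)))"
  have "?F (insert k S) * (1 - fps_X ^ k) = ?F S"
  proof (rule fps_ext)
    fix n
    have "k > 0" using insert.prems by (auto intro!: Nat.gr0I)
    thus "fps_nth (?F (insert k S) * (1 - fps_X ^ k)) n = fps_nth (?F S) n"
      using card_partitions_in_insert[of S k n] insert
      by (simp add: right_diff_distrib fps_X_power_mult_right_nth)
  qed
  thus ?case using insert by (simp add: mult.assoc[symmetric])
qed

text \<open>Parts of a bipartition of \<open>n\<close> are at most \<open>M\<close>, so the finite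
  set \<open>S\<close> loses none of them; the sum runs over the size \<open>i\<close> of the first
  component.\<close>

lemma B3_eq_convolution:
  assumes "n \<le> M"
  defines "S \<equiv> {k\<in>{1..M}. \<not> 3 dvd k}"
  shows "B3 (int n) = (\<Sum>i\<le>n. card (partitions_in S i) * card (partitions_in S (n - i)))"
proof -
  have "regular_bipartitions 3 (int n) = (\<Union>i\<in>{..n}. partitions_in S i \<times> partitions_in S (n - i))"
  proof -
    have reg: "regular_partition 3 P \<longleftrightarrow> set_mset P \<subseteq> S" if "\<Sum>\<^sub># P \<le> n" for P
    proof -
      have "x \<le> M" if "x \<in># P" for x
        using sum_mset.remove[OF that] \<open>\<Sum>\<^sub># P \<le> n\<close> assms(1) by simp
      thus ?thesis by (auto simp: regular_partition_def is_partition_def S_def)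
    qed
    have sum: "int (a + b) = int n \<longleftrightarrow> a \<le> n \<and> b \<le> n \<and> b = n - a" for a b by auto
    show ?thesis
      unfolding regular_bipartitions_def sum by (auto simp: partitions_in_def reg)
  qed
  moreover have fin: "finite (partitions_in S i)" for i
    by (intro finite_partitions_in) (simp add: S_def)
  ultimately have "B3 (int n) = (\<Sum>i\<le>n. card (partitions_in S i \<times> partitions_in S (n - i)))"
    unfolding B3_def by (simp only:) (subst card_UN_disjoint, auto simp: partitions_in_def)
  thus ?thesis by (simp add: card_cartesian_product)
qed

section \<open>Truncated congruences of power series\<close>

text \<open>Congruence modulo \<open>m\<close> and modulo \<open>fps_X ^ (M + 1)\<close> at once, so
  that finite products can stand for the infinite Euler products.\<close>

definition fps_cong :: "int \<Rightarrow> nat \<Rightarrow> int fps \<Rightarrow> int fps \<Rightarrow> bool" where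
  "fps_cong m M f g \<longleftrightarrow> (\<forall>i\<le>M. [fps_nth f i = fps_nth g i] (mod m))"

lemma fps_cong_refl [simp]: "fps_cong m M f f"
  by (simp add: fps_cong_def)

lemma fps_cong_sym: "fps_cong m M f g \<Longrightarrow> fps_cong m M g f"
  by (simp add: fps_cong_def cong_sym_eq)

lemma fps_cong_trans [trans]: "fps_cong m M f g \<Longrightarrow> fps_cong m M g h \<Longrightarrow> fps_cong m M f h"
  unfolding fps_cong_def using cong_trans by blast

lemma fps_cong_mult:
  "fps_cong m M f g \<Longrightarrow> fps_cong m M f' g' \<Longrightarrow> fps_cong m M (f * f') (g * g')"
  by (auto simp: fps_cong_def fps_mult_nth intro!: cong_sum cong_mult)

lemma fps_cong_prod:
  "(\<And>k. k \<in> A \<Longrightarrow> fps_cong m M (f k) (g k)) \<Longrightarrow> fps_cong m M (prod f A) (prod g A)"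
  by (induction A rule: infinite_finite_induct) (auto intro: fps_cong_mult)

text \<open>The Frobenius congruence: both middle binomial coefficients of a cube are 3.\<close>

lemma fps_cong_cube: "fps_cong 3 M ((1 - fps_X ^ k) ^ 3) (1 - (fps_X ^ 3) ^ k)"
proof -
  have "(1 - fps_X ^ k) ^ 3 = 1 - (fps_X ^ 3) ^ k + 3 * (fps_X ^ (2 * k) - fps_X ^ k :: int fps)"
    by (simp add: power_mult[symmetric] power3_eq_cube algebra_simps flip: power_add)
  thus ?thesis
    by (simp add: fps_cong_def cong_iff_dvd_diff numeral_fps_const)
qed

text \<open>The generating function is \<open>F ^ 2\<close> with \<open>F = 1 / D = T / E\<close>.
  Modulo 3, \<open>T\<close> and \<open>E ^ 3\<close> both agree with \<open>U\<close> up to degree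
  \<open>M\<close>, which turns \<open>F ^ 2\<close> into \<open>E * U\<close>.\<close>

lemma B3_cong_euler_products:
  "[int (B3 (int M)) = fps_nth ((\<Prod>k\<in>{1..M}. 1 - (fps_X ^ 1) ^ k) * (\<Prod>k\<in>{1..M}. 1 - (fps_X ^ 3) ^ k)) M] (mod 3)"
proof -
  define S where "S = {k\<in>{1..M}. \<not> 3 dvd k}"
  define F where "F = Abs_fps (\<lambda>n. int (card (partitions_in S n)))"
  define D where "D = (\<Prod>k\<in>S. 1 - fps_X ^ k :: int fps)"
  define T where "T = (\<Prod>k\<in>{k\<in>{1..M}. 3 dvd k}. 1 - fps_X ^ k :: int fps)"
  define E where "E = (\<Prod>k\<in>{1..M}. 1 - fps_X ^ k :: int fps)"
  define U where "U = (\<Prod>k\<in>{1..M}. 1 - (fps_X ^ 3) ^ k :: int fps)"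
  have FD: "F * D = 1"
    unfolding F_def D_def by (rule partitions_in_fps) (auto simp: S_def)
  have E: "E = D * T"
    unfolding E_def D_def T_def S_def
    by (subst prod.union_disjoint[symmetric]) (auto intro!: prod.cong)
  have EU: "fps_cong 3 M (E ^ 3) U"
    unfolding E_def U_def prod_power_distrib by (intro fps_cong_prod fps_cong_cube)
  \<comment> \<open>The factors of \<open>U\<close> missing from \<open>T\<close> have
    \<open>3 * k > M\<close>, so they equal 1 up to degree \<open>M\<close>.\<close>
  have TU: "fps_cong 3 M T U"
  proof -
    have "T = (\<Prod>k\<in>{1..M div 3}. 1 - (fps_X ^ 3) ^ k)"
      unfolding T_def
      by (rule prod.reindex_bij_witness[where i = "\<lambda>k. 3 * k" and j = "\<lambda>k. k div 3"])
         (auto simp flip: power_mult)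
    also have "\<dots> = (\<Prod>k\<in>{1..M}. if k \<le> M div 3 then 1 - (fps_X ^ 3) ^ k else 1)"
      by (rule prod.mono_neutral_cong_left) auto
    also have "fps_cong 3 M \<dots> U"
      unfolding U_def
    proof (rule fps_cong_prod)
      fix k
      have "fps_nth ((fps_X ^ 3) ^ k :: int fps) i = 0" if "\<not> k \<le> M div 3" "i \<le> M" for i
      proof -
        have "i \<noteq> 3 * k" using that by linarith
        thus ?thesis by (simp flip: power_mult)
      qed
      thus "fps_cong 3 M (if k \<le> M div 3 then 1 - (fps_X ^ 3) ^ k else 1) (1 - (fps_X ^ 3) ^ k)"
        by (auto simp: fps_cong_def)
    qed
    finally show ?thesis .
  qed
  \<comment> \<open>The inverse of \<open>T\<close>: it allows \<open>1 = T' * T\<close> to be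
    inserted and this \<open>T\<close> to be traded for \<open>E ^ 3\<close>, whose factor
    \<open>D ^ 2\<close> cancels \<open>F ^ 2\<close>.\<close>
  define T' where "T' = Abs_fps (\<lambda>n. int (card (partitions_in {k\<in>{1..M}. 3 dvd k} n)))"
  have T': "T' * T = 1"
    unfolding T'_def T_def by (rule partitions_in_fps) auto
  have "fps_cong 3 M (F ^ 2) (F ^ 2 * (T' * T))" by (simp add: T')
  also have "fps_cong 3 M \<dots> (F ^ 2 * (T' * E ^ 3))"
    by (intro fps_cong_mult fps_cong_refl fps_cong_trans[OF TU fps_cong_sym[OF EU]])
  also have "F ^ 2 * (T' * E ^ 3) = (F * D) ^ 2 * (T' * T) * (E * T)"
    by (simp add: E power2_eq_square power3_eq_cube algebra_simps)
  also have "\<dots> = E * T" by (simp add: FD T')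
  also have "fps_cong 3 M \<dots> (E * U)" by (intro fps_cong_mult fps_cong_refl TU)
  finally have "[fps_nth (F ^ 2) M = fps_nth (E * U) M] (mod 3)" by (simp add: fps_cong_def)
  moreover have "fps_nth (F ^ 2) M = int (B3 (int M))"
    by (simp add: B3_eq_convolution[of M M] power2_eq_square fps_mult_nth F_def S_def atMost_atLeast0)
  ultimately show ?thesis by (simp add: E_def U_def)
qed

text \<open>A nonzero coefficient of the product needs nonzero coefficients at some \<open>i\<close>
  and \<open>M - i\<close>; adding the two quadratic conditions eliminates \<open>i\<close>.\<close>

lemma B3_nonzero_mod_3:
  assumes "\<not> [B3 N = 0] (mod 3)"
  obtains x y :: int where "4 * (6 * N + 1) = x ^ 2 + 3 * y ^ 2"
proof -
  have "N \<ge> 0" using assms B3_neg[of N] by fastforce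
  then obtain M where N: "N = int M" using nonneg_int_cases by blast
  let ?E = "\<lambda>d. \<Prod>k\<in>{1..M}. 1 - (fps_X ^ d) ^ k :: int fps"
  have "\<not> [int (B3 (int M)) = 0] (mod 3)"
    using assms N cong_int_iff[of "B3 (int M)" 0 3] by simp
  hence "fps_nth (?E 1 * ?E 3) M \<noteq> 0"
    using B3_cong_euler_products[of M] by metis
  then obtain i where i: "i \<le> M" "fps_nth (?E 1) i * fps_nth (?E 3) (M - i) \<noteq> 0"
    unfolding fps_mult_nth by (metis (no_types, lifting) atLeastAtMost_iff sum.neutral)
  hence nz: "fps_nth (?E 1) i \<noteq> 0" "fps_nth (?E 3) (M - i) \<noteq> 0" by auto
  obtain x where x: "24 * int i + int 1 = int 1 * x ^ 2"
    using i(1) by (rule_tac euler_product_coeff_nonzero[OF _ _ nz(1)]) auto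
  obtain y where y: "24 * int (M - i) + int 3 = int 3 * y ^ 2"
    using i(1) by (rule_tac euler_product_coeff_nonzero[OF _ _ nz(2)]) auto
  have "4 * (6 * N + 1) = x ^ 2 + 3 * y ^ 2"
    using x y i(1) by (simp add: N of_nat_diff)
  thus thesis by (rule that)
qed

section \<open>The form \<open>x\<^sup>2 + 3 y\<^sup>2\<close> at primes congruent to 5 modulo 6\<close>

text \<open>Cubing is injective modulo \<open>p\<close> because \<open>p - 1 = 3 * m + 1\<close>: by
  Fermat, a unit \<open>c\<close> is the inverse of \<open>(c ^ 3) ^ m\<close>, hence determined by
  its cube.\<close>

lemma cube_cong_imp_cong:
  fixes a b :: int
  assumes p: "prime p" "[p = 2] (mod 3)" and ab: "[a ^ 3 = b ^ 3] (mod int p)"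
  shows "[a = b] (mod int p)"
proof (cases "int p dvd a")
  case True
  hence "int p dvd b ^ 3" using ab by (metis cong_dvd_iff dvd_power dvd_trans zero_less_numeral)
  hence "int p dvd b" using p(1) by (meson prime_dvd_power prime_nat_int_transfer)
  thus ?thesis using True by (simp add: cong_iff_dvd_diff)
next
  case False
  have pp: "prime (int p)" using p(1) by simp
  hence b: "\<not> int p dvd b"
    using False ab by (metis cong_dvd_iff dvd_power dvd_trans prime_dvd_power zero_less_numeral)
  have "p mod 3 = 2" using p(2) by (simp add: cong_def)
  define m where "m = p div 3"
  have m: "p - 1 = 3 * m + 1" using \<open>p mod 3 = 2\<close> unfolding m_def by presburger
  have one: "[(c ^ 3) ^ m * c = 1] (mod int p)" if "\<not> int p dvd c" for c
  proof -
    have "int p > 0" using p(1) prime_gt_0_nat by simp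
    then obtain u where u: "c mod int p = int u" by (metis nonneg_int_cases pos_mod_sign)
    hence cu: "[c = int u] (mod int p)" by (metis cong_mod_right cong_refl)
    hence "\<not> p dvd u" using that by (simp add: cong_dvd_iff[OF cong_sym] flip: int_dvd_int_iff)
    hence "[int u ^ (p - 1) = 1] (mod int p)"
      using fermat_theorem[OF p(1), of u] cong_int_iff[of "u ^ (p - 1)" 1 p] by simp
    hence "[c ^ (p - 1) = 1] (mod int p)" using cong_pow[OF cu] cong_trans by blast
    thus ?thesis by (simp only: m power_add power_mult power_one_right)
  qed
  have "[(a ^ 3) ^ m * a = (b ^ 3) ^ m * b] (mod int p)"
    using one[OF False] one[OF b] cong_sym cong_trans by blast
  also have "[(b ^ 3) ^ m * b = (a ^ 3) ^ m * b] (mod int p)"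
    by (intro cong_mult cong_pow cong_sym[OF ab] cong_refl)
  finally have "[(a ^ 3) ^ m * a = (a ^ 3) ^ m * b] (mod int p)" .
  moreover have "coprime ((a ^ 3) ^ m) (int p)"
    using prime_imp_coprime[OF pp False] by (simp add: coprime_commute)
  ultimately show ?thesis by (simp add: cong_mult_lcancel)
qed

text \<open>If \<open>x\<^sup>2 \<equiv> -3y\<^sup>2\<close>, then \<open>(x - y)\<^sup>3 \<equiv> (2y)\<^sup>3\<close>: up to scaling, \<open>x - y\<close> is \<open>2y\<close> times a cube root of unity.\<close>

lemma prime_dvd_x2_3y2:
  fixes x y :: int
  assumes p: "prime p" "p \<ge> 5" "[p = 5] (mod 6)" and dvd: "int p dvd x ^ 2 + 3 * y ^ 2"
  shows "int p dvd x \<and> int p dvd y"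
proof -
  have pp: "prime (int p)" using p(1) by simp
  have p3: "[p = 2] (mod 3)"
    using cong_dvd_modulus_nat[OF p(3), of 3] by (simp add: cong_def)
  have "(x - y) ^ 3 - (2 * y) ^ 3 = (x ^ 2 + 3 * y ^ 2) * (x - 3 * y)"
    by (simp add: power2_eq_square power3_eq_cube algebra_simps)
  hence "[(x - y) ^ 3 = (2 * y) ^ 3] (mod int p)"
    using dvd by (simp add: cong_iff_dvd_diff)
  hence "[x - y = 2 * y] (mod int p)" by (rule cube_cong_imp_cong[OF p(1) p3])
  hence d: "int p dvd x - 3 * y" by (simp add: cong_iff_dvd_diff algebra_simps)
  \<comment> \<open>Substituting \<open>x = 3 * y\<close> modulo \<open>p\<close> turns the form
    into \<open>12 * y ^ 2\<close>, and \<open>p\<close> is coprime to 12.\<close>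
  have "x ^ 2 + 3 * y ^ 2 = (x - 3 * y) * (x + 3 * y) + 12 * y ^ 2"
    by (simp add: power2_eq_square algebra_simps)
  hence "int p dvd 12 * y ^ 2" using dvd d by (metis dvd_add_right_iff dvd_mult2)
  moreover have "\<not> int p dvd 12"
  proof
    assume "int p dvd 12"
    hence "int p dvd 2 * 2 * 3" by simp
    hence "int p dvd 2 \<or> int p dvd 3" using pp by (metis prime_dvd_mult_iff)
    thus False using p(2) by (auto dest: zdvd_imp_le)
  qed
  ultimately have y: "int p dvd y"
    using pp by (meson prime_dvd_mult_iff prime_dvd_power)
  hence "int p dvd (x - 3 * y) + 3 * y" using d by (intro dvd_add dvd_mult)
  thus ?thesis using y by simp
qed

text \<open>Descent: once \<open>p\<close> divides the form it divides \<open>x\<close> and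
  \<open>y\<close>, so \<open>p ^ 2\<close> splits off and leaves a value of the same form.\<close>

lemma odd_prime_power_dvd_x2_3y2:
  fixes x y :: int
  assumes p: "prime p" "p \<ge> 5" "[p = 5] (mod 6)"
  shows "int p ^ (2 * k + 1) dvd x ^ 2 + 3 * y ^ 2 \<Longrightarrow> int p ^ (2 * k + 2) dvd x ^ 2 + 3 * y ^ 2"
proof (induction k arbitrary: x y)
  case 0
  hence "int p dvd x" "int p dvd y" using prime_dvd_x2_3y2[OF p, of x y] by simp_all
  hence "int p ^ 2 dvd x ^ 2" "int p ^ 2 dvd y ^ 2" by (simp_all only: dvd_power_same)
  hence "int p ^ 2 dvd x ^ 2 + 3 * y ^ 2" by (intro dvd_add dvd_mult)
  thus ?case by (simp add: power2_eq_square)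
next
  case (Suc k)
  hence "int p dvd x ^ 2 + 3 * y ^ 2"
    by (meson dvd_power dvd_trans add_gr_0 zero_less_one)
  then obtain u v where xy: "x = int p * u" "y = int p * v"
    using prime_dvd_x2_3y2[OF p, of x y] by (auto simp: dvd_def)
  have eq: "x ^ 2 + 3 * y ^ 2 = int p ^ 2 * (u ^ 2 + 3 * v ^ 2)"
    by (simp add: xy power_mult_distrib algebra_simps)
  have "int p ^ 2 * int p ^ (2 * k + 1) dvd int p ^ 2 * (u ^ 2 + 3 * v ^ 2)"
    using Suc.prems unfolding eq by (simp add: power2_eq_square)
  hence "int p ^ (2 * k + 1) dvd u ^ 2 + 3 * v ^ 2"
    using p(2) by (subst (asm) dvd_mult_cancel_left) auto
  hence "int p ^ (2 * k + 2) dvd u ^ 2 + 3 * v ^ 2" by (rule Suc.IH)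
  hence "int p ^ 2 * int p ^ (2 * k + 2) dvd int p ^ 2 * (u ^ 2 + 3 * v ^ 2)" by (rule mult_dvd_mono[OF dvd_refl])
  thus ?case unfolding eq by (simp add: power2_eq_square)
qed

theorem corollary1p4:
  fixes k n p :: nat and j :: int
  assumes "prime p" and "p \<ge> 5" and "[p = 5] (mod 6)"
    and "\<not> [j = 0] (mod int p)"
  shows "[B3 (int p ^ (2*k+2) * int n + int p ^ (2*k+1) * j + (int p ^ (2*k+2) - 1) div 6) = 0] (mod 3)"
proof (rule ccontr)
  let ?q = "int p ^ (2 * k + 1)"
  define N where "N = int p ^ (2*k+2) * int n + ?q * j + (int p ^ (2*k+2) - 1) div 6"
  assume "\<not> ?thesis"
  then obtain x y where xy: "4 * (6 * N + 1) = x ^ 2 + 3 * y ^ 2"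
    unfolding N_def[symmetric] by (rule B3_nonzero_mod_3)
  \<comment> \<open>An even power of \<open>p\<close> is therefore 1 modulo 6, which makes the
    division by 6 exact.\<close>
  have "[int p = -1] (mod 6)"
    using assms(3) cong_int_iff[of p 5 6] by (simp add: cong_def)
  hence "[(int p ^ 2) ^ (k + 1) = ((-1) ^ 2) ^ (k + 1)] (mod 6)" by (intro cong_pow)
  hence "6 dvd int p ^ (2*k+2) - 1"
    by (simp add: power_mult[symmetric] cong_iff_dvd_diff del: power_Suc)
  hence "6 * ((int p ^ (2*k+2) - 1) div 6) = int p ^ (2*k+2) - 1" by simp
  hence "6 * N + 1 = ?q * (6 * int p * int n + 6 * j + int p)"
    by (simp add: N_def algebra_simps)
  hence eq: "x ^ 2 + 3 * y ^ 2 = ?q * (4 * (6 * int p * int n + 6 * j + int p))"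
    using xy by (simp add: algebra_simps)
  hence "int p ^ (2 * k + 2) dvd x ^ 2 + 3 * y ^ 2"
    using odd_prime_power_dvd_x2_3y2[OF assms(1-3), of k x y] by simp
  hence "?q * int p dvd ?q * (4 * (6 * int p * int n + 6 * j + int p))"
    unfolding eq by (simp add: mult.commute)
  hence "int p dvd 4 * (6 * int p * int n + 6 * j + int p)"
    using assms(2) by (subst (asm) dvd_mult_cancel_left) auto
  \<comment> \<open>Modulo \<open>p\<close> the cofactor is \<open>24 * j\<close>, and the only
    primes dividing 24 are 2 and 3, both below \<open>p\<close>; so \<open>p\<close> would divide
    \<open>j\<close>.\<close>
  moreover have "4 * (6 * int p * int n + 6 * j + int p) = int p * (24 * int n + 4) + 24 * j"
    by (simp add: algebra_simps)
  ultimately have "int p dvd 24 * j" by (metis dvd_add_right_iff dvd_triv_left)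
  hence "int p dvd 2 * 2 * 2 * 3 * j" by simp
  hence "int p dvd 2 \<or> int p dvd 3 \<or> int p dvd j"
    using assms(1) by (metis prime_dvd_mult_iff prime_nat_int_transfer)
  thus False
    using assms(2,4) by (auto dest!: zdvd_imp_le simp: cong_0_iff)
qed

end
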